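(* Let $\mathcal{H},\mathcal{K}$ be real or complex Hilbert spaces and let $T$ be a densely defined linear operator from $\mathcal{K}$ to $\mathcal{H}$. The following assertions are equivalent: (i) $T$ is closed. (ii) $\operatorname{ran}M_{T^*,T}=\mathcal{H}\times\mathcal{K}$. (iii) $\operatorname{ran}(I+T^*T)=\mathcal{K}$ and $\operatorname{ran}(I+TT^* )=\mathcal{H}$. (iv) $T^*T$ and $TT^*$ are selfadjoint operators in the Hilbert spaces $\mathcal{K}$ and $\mathcal{H}$, respectively. (v) $G(T^* )^{\perp}\subseteq\operatorname{ran}M_{T^*,T}$. (vi) $T^*$ is densely defined and $T^{**}=T$.
   Context: Linear operators are defined on linear subspaces; products have their natural domains; equality of operators includes equality of domains. $T^*$, an operator from $\mathcal{H}$ to $\mathcal{K}$, is the adjoint of $T$ (a priori not necessarily densely defined). Selfadjoint means densely defined and equal to its adjoint. $G(T^* )=\{(h,T^*h):h\in\operatorname{dom}T^*\}\subseteq\mathcal{H}\times\mathcal{K}$ is the graph, and $\perp$ is taken in the product Hilbert space $\mathcal{H}\times\mathcal{K}$. $M_{T^*,T}$ is the operator in $\mathcal{H}\times\mathcal{K}$ with domain $\operatorname{dom}T^*\times\operatorname{dom}T$ given by $M_{T^*,T}(h,k)=(h-Tk,\,T^*h+k)$. *)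

theory Defs
  imports "HOL-Analysis.Analysis"
begin

text \<open>
  Real and complex Hilbert spaces are treated simultaneously. The scalars form a
  real normed field with a conjugation such that the norm is given by
  \<open>x * scnj x\<close>. Such a field is either \<open>\<real>\<close> with trivial conjugation or
  \<open>\<complex>\<close> with complex conjugation; see \<open>real_or_complex\<close> below.
\<close>

class rc_field = real_normed_field +
  fixes scnj :: "'a \<Rightarrow> 'a"
  assumes scnj_add: "scnj (x + y) = scnj x + scnj y"
    and scnj_mult: "scnj (x * y) = scnj x * scnj y"
    and scnj_scnj: "scnj (scnj x) = x"
    and scnj_scaleR: "scnj (r *\<^sub>R 1) = r *\<^sub>R 1"
    and mult_scnj_scaleR: "x * scnj x = (norm x)\<^sup>2 *\<^sub>R 1"

lemma scnj_of_real: "scnj (of_real r :: 'f::rc_field) = of_real r"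
  unfolding of_real_def by (rule scnj_scaleR)

lemma mult_scnj: "x * scnj x = (of_real ((norm x)\<^sup>2) :: 'f::rc_field)"
  unfolding of_real_def by (rule mult_scnj_scaleR)

instantiation real :: rc_field
begin
definition scnj_real :: "real \<Rightarrow> real" where "scnj_real x = x"
instance by standard (simp_all add: scnj_real_def power2_eq_square)
end

instantiation complex :: rc_field
begin
definition scnj_complex :: "complex \<Rightarrow> complex" where "scnj_complex = cnj"
instance by standard (simp_all add: scnj_complex_def complex_norm_square[symmetric]
      scaleR_conv_of_real)
end

lemma real_or_complex:
  "(UNIV = range (of_real :: real \<Rightarrow> 'f::rc_field) \<and> (\<forall>x::'f. scnj x = x))
    \<or> (\<exists>j::'f. j * j = - 1 \<and> scnj j = - j
         \<and> (\<forall>x. \<exists>a b. x = of_real a + of_real b * j))"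
proof -
  have minus: "scnj (- x) = - scnj x" for x :: 'f
    using scnj_mult[of "of_real (- 1)" x] by (simp only: scnj_of_real) simp
  have trace: "\<exists>r. x + scnj x = of_real r" for x :: 'f
  proof -
    have "scnj (1 + x) = 1 + scnj x"
      using scnj_of_real[of 1, where ?'f = 'f] by (simp add: scnj_add)
    then have "(1 + x) * (1 + scnj x) = of_real ((norm (1 + x))\<^sup>2)"
      using mult_scnj[of "1 + x"] by simp
    moreover have "(1 + x) * (1 + scnj x) = 1 + (x + scnj x) + x * scnj x"
      by (simp add: algebra_simps)
    ultimately have "x + scnj x = of_real ((norm (1 + x))\<^sup>2 - 1 - (norm x)\<^sup>2)"
      using mult_scnj[of x] by (simp add: algebra_simps)
    then show ?thesis ..
  qed
  have fixed: "\<exists>r. x = of_real r" if sx: "scnj x = x" for x :: 'f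
  proof -
    obtain r where "x + x = of_real r" using trace[of x] sx by metis
    then have "x = of_real (r / 2)" by (simp add: field_simps)
    then show ?thesis ..
  qed
  show ?thesis
  proof (cases "\<forall>x::'f. scnj x = x")
    case True
    with fixed show ?thesis by blast
  next
    case False
    then obtain x :: 'f where x: "scnj x \<noteq> x" by blast
    define y where "y = x - scnj x"
    define u where "u = y / of_real (norm y)"
    have y: "y \<noteq> 0" "scnj y = - y"
      using x scnj_add[of x "- scnj x"] by (auto simp: y_def minus scnj_scnj)
    have u: "u * of_real (norm y) = y" using y by (simp add: u_def)
    have "scnj u * of_real (norm y) = - u * of_real (norm y)"
      using scnj_mult[of u "of_real (norm y)"] u y by (simp add: scnj_of_real)
    moreover have "of_real (norm y) \<noteq> (0::'f)" using y by simp
    ultimately have su: "scnj u = - u" using mult_right_cancel by blast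
    have "norm u = 1" using y by (simp add: u_def norm_divide)
    with mult_scnj[of u] su have "- (u * u) = 1" by simp
    then have uu: "u * u = - 1" by (metis minus_minus)
    have "\<exists>a b. z = of_real a + of_real b * u" for z :: 'f
    proof -
      obtain r where r: "z + scnj z = of_real r" using trace by blast
      have "scnj (z - scnj z) = - (z - scnj z)"
        using scnj_add[of z "- scnj z"] by (simp add: minus scnj_scnj)
      then have "scnj ((z - scnj z) * u) = (z - scnj z) * u"
        by (simp only: scnj_mult su minus_mult_minus)
      then obtain s where s: "(z - scnj z) * u = of_real s" using fixed by blast
      have "z - scnj z = - ((z - scnj z) * u) * u" using uu by (simp add: mult.assoc)
      then have "z - scnj z = of_real (- s) * u" using s by simp
      moreover have "z + z = (z + scnj z) + (z - scnj z)" by simp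
      ultimately have "z + z = of_real r + of_real (- s) * u" unfolding r by simp
      then have "z = of_real (r / 2) + of_real (- s / 2) * u" by (simp add: field_simps)
      then show ?thesis by blast
    qed
    with uu su show ?thesis by blast
  qed
qed

text \<open>
  The type class of \<open>'a\<close> supplies norm, topology and completeness; its real inner
  product is the real part of \<open>ip\<close>. The form \<open>ip\<close> is linear in the first argument.
\<close>

locale hilbert_space = vector_space scale
  for scale :: "'f::rc_field \<Rightarrow> 'a::{real_inner, complete_space} \<Rightarrow> 'a" +
  fixes ip :: "'a \<Rightarrow> 'a \<Rightarrow> 'f"
  assumes scale_of_real: "scale (of_real r) x = r *\<^sub>R x"
    and ip_add_left: "ip (x + y) z = ip x z + ip y z"
    and ip_scale_left: "ip (scale c x) y = c * ip x y"
    and ip_commute: "ip y x = scnj (ip x y)"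
    and ip_self: "ip x x = of_real ((norm x)\<^sup>2)"

lemma hilbert_space_real:
  "hilbert_space (scaleR :: real \<Rightarrow> 'a::{real_inner, complete_space} \<Rightarrow> 'a) inner"
  by unfold_locales
    (simp_all add: scnj_real_def algebra_simps inner_commute power2_norm_eq_inner)

lemma hilbert_space_complex: "hilbert_space (*) (\<lambda>x y. x * cnj y :: complex)"
  by unfold_locales
    (simp_all add: scnj_complex_def algebra_simps scaleR_conv_of_real
      complex_norm_square[symmetric])

definition scale_prod ::
  "('f \<Rightarrow> 'a \<Rightarrow> 'a) \<Rightarrow> ('f \<Rightarrow> 'b \<Rightarrow> 'b) \<Rightarrow> 'f \<Rightarrow> 'a \<times> 'b \<Rightarrow> 'a \<times> 'b"
  where "scale_prod s t c = map_prod (s c) (t c)"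

definition ip_prod ::
  "('a \<Rightarrow> 'a \<Rightarrow> 'f::plus) \<Rightarrow> ('b \<Rightarrow> 'b \<Rightarrow> 'f) \<Rightarrow> 'a \<times> 'b \<Rightarrow> 'a \<times> 'b \<Rightarrow> 'f"
  where "ip_prod ipA ipB p q = ipA (fst p) (fst q) + ipB (snd p) (snd q)"

lemma hilbert_space_prod:
  assumes "hilbert_space s ipA" and "hilbert_space t ipB"
  shows "hilbert_space (scale_prod s t) (ip_prod ipA ipB)"
proof -
  interpret A: hilbert_space s ipA by fact
  interpret B: hilbert_space t ipB by fact
  show ?thesis
  proof unfold_locales
    fix x y :: "'b \<times> 'c"
    show "ip_prod ipA ipB y x = scnj (ip_prod ipA ipB x y)"
      using A.ip_commute[of "fst y" "fst x"] B.ip_commute[of "snd y" "snd x"]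
      by (simp add: ip_prod_def scnj_add)
  qed (auto simp: scale_prod_def ip_prod_def algebra_simps A.scale_of_real B.scale_of_real
      A.ip_add_left B.ip_add_left A.ip_scale_left B.ip_scale_left A.ip_self B.ip_self
      A.scale_right_distrib B.scale_right_distrib A.scale_left_distrib B.scale_left_distrib
      norm_prod_def)
qed

definition orth_compl :: "('a \<Rightarrow> 'a \<Rightarrow> 'f::zero) \<Rightarrow> 'a set \<Rightarrow> 'a set"
  where "orth_compl ip S = {x. \<forall>y\<in>S. ip x y = 0}"

text \<open>
  Operators are partial functions, so that equality includes equality of domains,
  \<open>\<circ>\<^sub>m\<close> is composition on the natural domain, and \<open>Some\<close> is the identity operator.
\<close>

definition linear_operator ::
  "('f::field \<Rightarrow> 'a::ab_group_add \<Rightarrow> 'a) \<Rightarrow> ('f \<Rightarrow> 'b::ab_group_add \<Rightarrow> 'b) \<Rightarrow> ('a \<rightharpoonup> 'b) \<Rightarrow> bool"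
  where "linear_operator s t T \<longleftrightarrow>
    module.subspace s (dom T) \<and>
    (\<forall>x\<in>dom T. \<forall>y\<in>dom T. the (T (x + y)) = the (T x) + the (T y)) \<and>
    (\<forall>c. \<forall>x\<in>dom T. the (T (s c x)) = t c (the (T x)))"

definition densely_defined :: "('a::topological_space \<rightharpoonup> 'b) \<Rightarrow> bool"
  where "densely_defined T \<longleftrightarrow> closure (dom T) = UNIV"

definition closed_operator :: "('a::topological_space \<rightharpoonup> 'b::topological_space) \<Rightarrow> bool"
  where "closed_operator T \<longleftrightarrow> closed (Map.graph T)"

definition operator_sum :: "('a \<rightharpoonup> 'b::plus) \<Rightarrow> ('a \<rightharpoonup> 'b) \<Rightarrow> ('a \<rightharpoonup> 'b)"
  where "operator_sum S T x =
    (case (S x, T x) of (Some u, Some v) \<Rightarrow> Some (u + v) | _ \<Rightarrow> None)"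

text \<open>The vector \<open>z\<close> below is unique if \<open>T\<close> is densely defined; otherwise \<open>adjoint_operator\<close> is not
  meaningful.\<close>

definition adjoint_operator ::
  "('a \<Rightarrow> 'a \<Rightarrow> 'f) \<Rightarrow> ('b \<Rightarrow> 'b \<Rightarrow> 'f) \<Rightarrow> ('a \<rightharpoonup> 'b) \<Rightarrow> ('b \<rightharpoonup> 'a)"
  where "adjoint_operator ipA ipB T y =
    (if \<exists>z. \<forall>x\<in>dom T. ipB (the (T x)) y = ipA x z
     then Some (THE z. \<forall>x\<in>dom T. ipB (the (T x)) y = ipA x z)
     else None)"

definition selfadjoint :: "('a::topological_space \<Rightarrow> 'a \<Rightarrow> 'f) \<Rightarrow> ('a \<rightharpoonup> 'a) \<Rightarrow> bool"
  where "selfadjoint ip T \<longleftrightarrow> densely_defined T \<and> adjoint_operator ip ip T = T"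

definition M_op ::
  "('h::ab_group_add \<rightharpoonup> 'k::ab_group_add) \<Rightarrow> ('k \<rightharpoonup> 'h) \<Rightarrow> ('h \<times> 'k \<rightharpoonup> 'h \<times> 'k)"
  where "M_op S T = (\<lambda>(h, k).
    (case (S h, T k) of (Some u, Some v) \<Rightarrow> Some (h - v, u + k) | _ \<Rightarrow> None))"

end

theory Submission
  imports Defs
begin

text \<open>
  Let \<open>V = {(- T k, k)}\<close>. Then \<open>G(T\<^sup>*) = V\<^sup>\<bottom>\<close>, so \<open>ran M = V + V\<^sup>\<bottom>\<close>, and by the
  projection theorem this sum is everything, or at least contains \<open>V\<^sup>\<bottom>\<^sup>\<bottom>\<close>, iff \<open>V\<close> is closed.
  The equations \<open>M (T u, u) = (0, u + T\<^sup>* T u)\<close> and \<open>M (w, - T\<^sup>* w) = (w + T T\<^sup>* w, 0)\<close> connect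
  (ii) with (iii). Both \<open>T\<^sup>* T\<close> and \<open>T T\<^sup>*\<close> are symmetric and nonnegative, and such an operator \<open>A\<close>
  is selfadjoint iff \<open>I + A\<close> is surjective. Scalars play no role in any of this: on
  sets invariant under scalar multiplication, orthogonality with respect to \<open>ip\<close> agrees with
  orthogonality with respect to its real part.
\<close>

section \<open>Orthogonal decomposition\<close>

lemma mem_orth_compl: "x \<in> orth_compl ip S \<longleftrightarrow> (\<forall>y\<in>S. ip x y = 0)"
  by (simp add: orth_compl_def)

text \<open>The squared norm of \<open>q - t *\<^sub>R y\<close> is a quadratic in \<open>t\<close>.
  Its minimum lies below the value at 0 by \<open>(inner q y)\<^sup>2 / inner y y\<close>, so
  minimality at 0 forces the numerator to vanish.\<close>

lemma minimizer_imp_orthogonal: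
  fixes q y :: "'a::real_inner"
  assumes "\<And>t. norm q \<le> norm (q - t *\<^sub>R y)"
  shows "inner q y = 0"
proof (cases "y = 0")
  case False
  define t where "t = inner q y / inner y y"
  have pos: "inner y y > 0" using False by simp
  have "inner q q \<le> inner (q - t *\<^sub>R y) (q - t *\<^sub>R y)"
    using assms[of t] by (simp add: norm_le)
  also have "\<dots> = inner q q - 2 * t * inner q y + t * t * inner y y"
    by (simp add: inner_diff_left inner_diff_right inner_commute algebra_simps)
  also have "\<dots> = inner q q - (inner q y)\<^sup>2 / inner y y"
    using pos by (simp add: t_def field_simps power2_eq_square)
  finally have "(inner q y)\<^sup>2 / inner y y \<le> 0" by simp
  then have "(inner q y)\<^sup>2 \<le> 0" using pos by (simp add: divide_le_0_iff)
  then show ?thesis by simp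
qed simp

text \<open>By the parallelogram law a minimizing sequence is Cauchy, because midpoints of its
  members stay in \<open>S\<close> and so are no closer to \<open>x\<close> than the infimum
  \<open>d\<close>. Its limit lies in \<open>S\<close> by closedness.\<close>

lemma closed_subspace_nearest_point:
  fixes S :: "'a::{real_inner, complete_space} set"
  assumes S: "closed S" "subspace S"
  shows "\<exists>p\<in>S. \<forall>y\<in>S. norm (x - p) \<le> norm (x - y)"
proof -
  define d where "d = (INF y\<in>S. norm (x - y))"
  have ne: "S \<noteq> {}" using subspace_0[OF S(2)] by auto
  have bdd: "bdd_below ((\<lambda>y. norm (x - y)) ` S)"
    by (rule bdd_belowI[of _ 0]) auto
  have d_le: "d \<le> norm (x - y)" if "y \<in> S" for y
    unfolding d_def using bdd that by (rule cINF_lower)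
  have d0: "d \<ge> 0" unfolding d_def using ne by (intro cINF_greatest) auto
  have "\<exists>y\<in>S. norm (x - y) < d + inverse (real (Suc n))" for n
    using cINF_less_iff[OF ne bdd, of "d + inverse (real (Suc n))"] by (simp add: d_def)
  then obtain f where f: "\<And>n. f n \<in> S"
      "\<And>n. norm (x - f n) < d + inverse (real (Suc n))"
    by metis
  have lim: "(\<lambda>n. norm (x - f n)) \<longlonglongrightarrow> d"
  proof (rule tendsto_sandwich[of "\<lambda>_. d"])
    show "(\<lambda>n. d + inverse (real (Suc n))) \<longlonglongrightarrow> d"
      using tendsto_add[OF tendsto_const LIMSEQ_inverse_real_of_nat] by simp
    show "eventually (\<lambda>n. norm (x - f n) \<le> d + inverse (real (Suc n))) sequentially"
      by (rule always_eventually) (blast intro: less_imp_le f(2))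
  qed (auto intro!: always_eventually d_le f(1))
  have par: "(norm (f m - f n))\<^sup>2 \<le> 2 * (norm (x - f m))\<^sup>2 + 2 * (norm (x - f n))\<^sup>2 - 4 * d\<^sup>2"
    for m n
  proof -
    have "(1/2) *\<^sub>R (f m + f n) \<in> S" using S(2) f(1) by (intro subspace_scale subspace_add) auto
    then have "d\<^sup>2 \<le> (norm (x - (1/2) *\<^sub>R (f m + f n)))\<^sup>2"
      using d_le d0 by (intro power_mono) auto
    moreover have "(norm (f m - f n))\<^sup>2 + 4 * (norm (x - (1/2) *\<^sub>R (f m + f n)))\<^sup>2
        = 2 * (norm (x - f m))\<^sup>2 + 2 * (norm (x - f n))\<^sup>2"
      unfolding power2_norm_eq_inner
      by (simp add: inner_diff_left inner_diff_right inner_add_left inner_add_right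
          inner_commute algebra_simps)
    ultimately show ?thesis by linarith
  qed
  have "Cauchy f"
  proof (rule metric_CauchyI)
    fix e :: real assume e: "e > 0"
    have "(\<lambda>n. (norm (x - f n))\<^sup>2) \<longlonglongrightarrow> d\<^sup>2" by (intro tendsto_intros lim)
    \<comment> \<open>With the excess \<open>e\<^sup>2 / 4\<close> at both indices, the multiples of
      \<open>d\<^sup>2\<close> in \<open>par\<close> cancel and exactly \<open>e\<^sup>2\<close>
      remains.\<close>
    then have "eventually (\<lambda>n. (norm (x - f n))\<^sup>2 < d\<^sup>2 + e\<^sup>2 / 4) sequentially"
      by (rule order_tendstoD) (use e in simp)
    then obtain N where N: "\<And>n. n \<ge> N \<Longrightarrow> (norm (x - f n))\<^sup>2 < d\<^sup>2 + e\<^sup>2 / 4"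
      by (auto simp: eventually_sequentially)
    have "dist (f m) (f n) < e" if "m \<ge> N" "n \<ge> N" for m n
    proof -
      have "(norm (f m - f n))\<^sup>2 < e\<^sup>2" using par[of m n] N[OF that(1)] N[OF that(2)] by linarith
      then show ?thesis using e by (simp add: dist_norm power_less_imp_less_base)
    qed
    then show "\<exists>M. \<forall>m\<ge>M. \<forall>n\<ge>M. dist (f m) (f n) < e" by blast
  qed
  then obtain p where p: "f \<longlonglongrightarrow> p" using Cauchy_convergent convergent_def by blast
  have "(\<lambda>n. norm (x - f n)) \<longlonglongrightarrow> norm (x - p)" by (intro tendsto_intros p)
  then have "norm (x - p) = d" using lim LIMSEQ_unique by blast
  moreover have "p \<in> S" using S(1) f(1) p closed_sequentially by blast
  ultimately show ?thesis using d_le by auto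
qed

text \<open>Take \<open>p\<close> as the nearest point to \<open>x\<close>. The residual
  \<open>x - p\<close> cannot be shortened along any direction of \<open>S\<close>, hence is
  orthogonal to \<open>S\<close>.\<close>

lemma orthogonal_decomposition:
  fixes S :: "'a::{real_inner, complete_space} set"
  assumes "closed S" "subspace S"
  obtains p q where "p \<in> S" "q \<in> orth_compl inner S" "x = p + q"
proof -
  obtain p where p: "p \<in> S" "\<And>y. y \<in> S \<Longrightarrow> norm (x - p) \<le> norm (x - y)"
    using closed_subspace_nearest_point[OF assms] by blast
  have "inner (x - p) y = 0" if "y \<in> S" for y
  proof (rule minimizer_imp_orthogonal)
    fix t
    have "p + t *\<^sub>R y \<in> S" using assms(2) p(1) that by (intro subspace_add subspace_scale)
    from p(2)[OF this] show "norm (x - p) \<le> norm (x - p - t *\<^sub>R y)"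
      by (simp add: algebra_simps)
  qed
  then show ?thesis using p(1) that[of p "x - p"] by (simp add: mem_orth_compl)
qed

lemma closed_orth_compl_inner: "closed (orth_compl inner S)"
proof -
  have "orth_compl inner S = (\<Inter>y\<in>S. {x. inner x y = 0})" by (auto simp: orth_compl_def)
  then show ?thesis by (auto intro!: closed_INT closed_Collect_eq continuous_intros)
qed

text \<open>Closedness gives \<open>R = UNIV\<close>, which trivially gives the inclusion, and the
  inclusion gives closedness back: if \<open>x = v + w\<close> lies in the double complement, then
  \<open>w\<close> is orthogonal to \<open>x\<close> and to \<open>v\<close>, hence to itself. So
  \<open>V\<close> equals its double complement, and complements are closed.\<close>

lemma closed_subspace_iff_decomposition:
  fixes V :: "'a::{real_inner, complete_space} set"
  assumes V: "subspace V"
  defines "R \<equiv> {v + w | v w. v \<in> V \<and> w \<in> orth_compl inner V}"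
  shows "closed V \<longleftrightarrow> R = UNIV"
    and "closed V \<longleftrightarrow> orth_compl inner (orth_compl inner V) \<subseteq> R"
proof -
  have 1: "R = UNIV" if "closed V"
    using orthogonal_decomposition[OF that V] unfolding R_def by blast
  have 2: "closed V" if R: "orth_compl inner (orth_compl inner V) \<subseteq> R"
  proof -
    have "x \<in> V" if x: "x \<in> orth_compl inner (orth_compl inner V)" for x
    proof -
      obtain v w where vw: "v \<in> V" "w \<in> orth_compl inner V" "x = v + w"
        using R x by (auto simp: R_def)
      have "inner x w = 0" using x vw(2) by (simp add: mem_orth_compl)
      moreover have "inner v w = 0" using vw by (simp add: mem_orth_compl inner_commute)
      ultimately have "w = 0" using vw(3) by (simp add: inner_add_left)
      then show ?thesis using vw by simp
    qed
    moreover have "V \<subseteq> orth_compl inner (orth_compl inner V)"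
      by (auto simp: orth_compl_def inner_commute)
    ultimately have "V = orth_compl inner (orth_compl inner V)" by blast
    then show ?thesis using closed_orth_compl_inner by metis
  qed
  show "closed V \<longleftrightarrow> R = UNIV" using 1 2 by blast
  show "closed V \<longleftrightarrow> orth_compl inner (orth_compl inner V) \<subseteq> R" using 1 2 by blast
qed

lemma closed_subspace_biorthogonal:
  fixes V :: "'a::{real_inner, complete_space} set"
  assumes "subspace V" "closed V" "x \<in> orth_compl inner (orth_compl inner V)"
  shows "x \<in> V"
proof -
  obtain p q where pq: "p \<in> V" "q \<in> orth_compl inner V" "x = p + q"
    using orthogonal_decomposition[OF assms(2,1)] by blast
  have "inner x q = 0" using assms(3) pq(2) by (simp add: mem_orth_compl)
  moreover have "inner p q = 0" using pq by (simp add: mem_orth_compl inner_commute)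
  ultimately have "q = 0" using pq(3) by (simp add: inner_add_left)
  then show ?thesis using pq by simp
qed

section \<open>Closures and dense subspaces\<close>

lemma subspace_closure:
  fixes V :: "'a::real_normed_vector set"
  assumes "subspace V"
  shows "subspace (closure V)"
proof (rule subspaceI)
  show "0 \<in> closure V" using subspace_0[OF assms] closure_subset by blast
  show "x + y \<in> closure V" if xy: "x \<in> closure V" "y \<in> closure V" for x y
  proof -
    obtain f g where fg: "\<And>n. f n \<in> V" "f \<longlonglongrightarrow> x" "\<And>n. g n \<in> V" "g \<longlonglongrightarrow> y"
      using xy unfolding closure_sequential by blast
    have "(\<lambda>n. f n + g n) \<longlonglongrightarrow> x + y" using fg by (intro tendsto_add)
    moreover have "f n + g n \<in> V" for n using fg by (intro subspace_add[OF assms])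
    ultimately show ?thesis
      unfolding closure_sequential by (intro exI[of _ "\<lambda>n. f n + g n"]) simp
  qed
  show "c *\<^sub>R x \<in> closure V" if "x \<in> closure V" for c x
  proof -
    obtain f where f: "\<And>n. f n \<in> V" "f \<longlonglongrightarrow> x"
      using \<open>x \<in> closure V\<close> unfolding closure_sequential by blast
    have "(\<lambda>n. c *\<^sub>R f n) \<longlonglongrightarrow> c *\<^sub>R x" using f by (intro tendsto_intros)
    moreover have "c *\<^sub>R f n \<in> V" for n using f by (intro subspace_scale[OF assms])
    ultimately show ?thesis
      unfolding closure_sequential by (intro exI[of _ "\<lambda>n. c *\<^sub>R f n"]) simp
  qed
qed

text \<open>Decompose along the closure of \<open>V\<close>: the orthogonal component of any vector
  is in particular orthogonal to \<open>V\<close>, hence zero.\<close>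

lemma dense_subspaceI:
  fixes V :: "'a::{real_inner, complete_space} set"
  assumes "subspace V" "\<And>z. z \<in> orth_compl inner V \<Longrightarrow> z = 0"
  shows "closure V = UNIV"
proof -
  have "x \<in> closure V" for x
  proof -
    obtain p q where pq: "p \<in> closure V" "q \<in> orth_compl inner (closure V)" "x = p + q"
      using orthogonal_decomposition[OF closed_closure subspace_closure[OF assms(1)]] by blast
    have "q \<in> orth_compl inner V" using pq(2) closure_subset by (force simp: mem_orth_compl)
    then have "q = 0" by (rule assms(2))
    then show ?thesis using pq by simp
  qed
  then show ?thesis by blast
qed

lemma orthogonal_dense_imp_zero:
  assumes "closure V = UNIV" "z \<in> orth_compl inner V"
  shows "z = 0"
proof -
  have "V \<subseteq> {x. inner z x = 0}" using assms(2) by (auto simp: orth_compl_def)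
  then have "closure V \<subseteq> {x. inner z x = 0}"
    by (intro closure_minimal closed_Collect_eq continuous_intros)
  then have "inner z z = 0" using assms(1) by blast
  then show ?thesis by simp
qed

section \<open>Operators with linear graph\<close>

text \<open>Eliminates the definite description: two candidates for \<open>z\<close> differ by a
  vector orthogonal to the dense domain, so they coincide.\<close>

lemma adjoint_operator_Some_iff:
  fixes T :: "'a::real_inner \<rightharpoonup> 'b::real_inner"
  assumes "densely_defined T"
  shows "adjoint_operator inner inner T y = Some z \<longleftrightarrow>
    (\<forall>x u. T x = Some u \<longrightarrow> inner u y = inner x z)"
proof -
  let ?P = "\<lambda>z. \<forall>x\<in>dom T. inner (the (T x)) y = inner x z"
  have uniq: "a = b" if "?P a" "?P b" for a b
  proof -
    have "inner (a - b) x = 0" if "x \<in> dom T" for x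
      using \<open>?P a\<close> \<open>?P b\<close> that by (metis inner_diff_right inner_commute diff_self)
    then have "a - b \<in> orth_compl inner (dom T)" by (simp add: mem_orth_compl)
    then have "a - b = 0"
      using assms unfolding densely_defined_def by (blast intro: orthogonal_dense_imp_zero)
    then show ?thesis by simp
  qed
  have eq: "adjoint_operator inner inner T y = (if \<exists>z. ?P z then Some (THE z. ?P z) else None)"
    by (rule adjoint_operator_def)
  have "adjoint_operator inner inner T y = Some z \<longleftrightarrow> ?P z"
  proof
    assume "adjoint_operator inner inner T y = Some z"
    then have ex: "\<exists>z. ?P z" and z: "(THE z. ?P z) = z"
      unfolding eq by (auto split: if_splits)
    from ex obtain z' where z': "?P z'" ..
    have "?P (THE z. ?P z)" using z' by (rule theI) (rule uniq[OF _ z'])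
    then show "?P z" unfolding z .
  next
    assume P: "?P z"
    then have "(THE z. ?P z) = z" by (rule the_equality) (rule uniq[OF _ P])
    moreover have "\<exists>z. ?P z" using P ..
    ultimately show "adjoint_operator inner inner T y = Some z"
      unfolding eq by (simp only: if_True)
  qed
  also have "?P z \<longleftrightarrow> (\<forall>x u. T x = Some u \<longrightarrow> inner u y = inner x z)"
    unfolding dom_def by (metis (mono_tags, lifting) mem_Collect_eq option.collapse option.discI option.sel)
  finally show ?thesis .
qed

text \<open>Real linearity of a partial map is carried as the statement that its graph is a real
  subspace; these are the rules for using it.\<close>

lemma subspace_graphD:
  assumes "subspace (Map.graph A)"
  shows "A 0 = Some 0"
    and "\<And>x y u v. A x = Some u \<Longrightarrow> A y = Some v \<Longrightarrow> A (x + y) = Some (u + v)"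
    and "\<And>c x u. A x = Some u \<Longrightarrow> A (c *\<^sub>R x) = Some (c *\<^sub>R u)"
    and "\<And>x u. A x = Some u \<Longrightarrow> A (- x) = Some (- u)"
proof -
  show "A 0 = Some 0" using subspace_0[OF assms] by (simp add: graph_def zero_prod_def)
  show "A (x + y) = Some (u + v)" if "A x = Some u" "A y = Some v" for x y u v
    using subspace_add[OF assms, of "(x, u)" "(y, v)"] that by (simp add: graph_def)
  show "A (c *\<^sub>R x) = Some (c *\<^sub>R u)" if "A x = Some u" for c x u
    using subspace_scale[OF assms, of "(x, u)" c] that by (simp add: graph_def)
  show "A (- x) = Some (- u)" if "A x = Some u" for x u
    using subspace_neg[OF assms, of "(x, u)"] that by (simp add: graph_def)
qed

lemma subspace_graphI:
  assumes "A 0 = Some 0"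
    and "\<And>x y u v. A x = Some u \<Longrightarrow> A y = Some v \<Longrightarrow> A (x + y) = Some (u + v)"
    and "\<And>c x u. A x = Some u \<Longrightarrow> A (c *\<^sub>R x) = Some (c *\<^sub>R u)"
  shows "subspace (Map.graph A)"
proof (rule subspaceI)
  show "0 \<in> Map.graph A" using assms(1) by (simp add: graph_def zero_prod_def)
  show "p + q \<in> Map.graph A" if "p \<in> Map.graph A" "q \<in> Map.graph A" for p q
    using that assms(2) unfolding graph_def by force
  show "c *\<^sub>R p \<in> Map.graph A" if "p \<in> Map.graph A" for c p
    using that assms(3) unfolding graph_def by force
qed

lemma subspace_dom:
  assumes "subspace (Map.graph A)"
  shows "subspace (dom A)"
  using subspace_graphD(1-3)[OF assms] by (intro subspaceI) blast+

lemma subspace_graph_comp: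
  assumes "subspace (Map.graph A)" "subspace (Map.graph B)"
  shows "subspace (Map.graph (A \<circ>\<^sub>m B))"
proof (rule subspace_graphI)
  note A = subspace_graphD[OF assms(1)] and B = subspace_graphD[OF assms(2)]
  show "(A \<circ>\<^sub>m B) 0 = Some 0" using A(1) B(1) by (simp add: map_comp_Some_iff)
  show "(A \<circ>\<^sub>m B) (x + y) = Some (u + v)"
    if "(A \<circ>\<^sub>m B) x = Some u" "(A \<circ>\<^sub>m B) y = Some v" for x y u v
    using that A(2) B(2) unfolding map_comp_Some_iff by blast
  show "(A \<circ>\<^sub>m B) (c *\<^sub>R x) = Some (c *\<^sub>R u)" if "(A \<circ>\<^sub>m B) x = Some u" for c x u
    using that A(3) B(3) unfolding map_comp_Some_iff by blast
qed

lemma subspace_graph_adjoint: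
  fixes T :: "'a::real_inner \<rightharpoonup> 'b::real_inner"
  assumes "densely_defined T"
  shows "subspace (Map.graph (adjoint_operator inner inner T))"
  by (intro subspace_graphI)
    (auto simp: adjoint_operator_Some_iff[OF assms] inner_add_right)

lemma ran_operator_sum_Some_iff:
  "y \<in> ran (operator_sum Some A) \<longleftrightarrow> (\<exists>x u. A x = Some u \<and> y = x + u)"
proof -
  have "operator_sum Some A x = Some y \<longleftrightarrow> (\<exists>u. A x = Some u \<and> y = x + u)" for x
    by (cases "A x") (auto simp: operator_sum_def)
  then show ?thesis by (simp add: ran_def)
qed

lemma ran_M_op_iff:
  "p \<in> ran (M_op S T) \<longleftrightarrow> (\<exists>h u k v. S h = Some u \<and> T k = Some v \<and> p = (h - v, u + k))"
proof -
  have "M_op S T (h, k) = Some p \<longleftrightarrow>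
      (\<exists>u v. S h = Some u \<and> T k = Some v \<and> p = (h - v, u + k))" for h k
    by (cases "S h"; cases "T k") (auto simp: M_op_def)
  then show ?thesis by (simp add: ran_def) blast
qed

section \<open>Selfadjointness and surjectivity of I + A\<close>

text \<open>If \<open>A\<close> is selfadjoint, nonnegativity bounds I + A from below, so its range
  is closed; the range is also dense because its orthogonal complement is the kernel of I + A.
  Conversely, surjectivity yields a dense domain and, with symmetry, leaves no room for the adjoint
  to extend \<open>A\<close> properly.\<close>

lemma symmetric_nonneg_selfadjoint_iff:
  fixes A :: "'a::{real_inner, complete_space} \<rightharpoonup> 'a"
  assumes sub: "subspace (Map.graph A)"
    and sym: "\<And>x u y v. A x = Some u \<Longrightarrow> A y = Some v \<Longrightarrow> inner u y = inner x v"
    and nonneg: "\<And>x u. A x = Some u \<Longrightarrow> inner u x \<ge> 0"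
  shows "selfadjoint inner A \<longleftrightarrow> ran (operator_sum Some A) = UNIV"
proof
  assume "selfadjoint inner A"
  then have dense: "densely_defined A" and eq: "adjoint_operator inner inner A = A"
    by (auto simp: selfadjoint_def)
  have A: "A y = Some z \<longleftrightarrow> (\<forall>x u. A x = Some u \<longrightarrow> inner u y = inner x z)" for y z
    using adjoint_operator_Some_iff[OF dense] unfolding eq .
  let ?R = "ran (operator_sum Some A)"
  have bound: "norm x \<le> norm (x + u)" if "A x = Some u" for x u
  proof -
    have "norm x * norm x \<le> inner (x + u) x"
      using nonneg[OF that] by (simp add: inner_add_left dot_square_norm power2_eq_square)
    also have "\<dots> \<le> norm (x + u) * norm x" by (rule norm_cauchy_schwarz)
    finally show ?thesis by (cases "x = 0") auto
  qed
  have "subspace ?R"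
  proof (rule subspaceI)
    show "0 \<in> ?R" using subspace_graphD(1)[OF sub] by (force simp: ran_operator_sum_Some_iff)
    show "a + b \<in> ?R" if ab: "a \<in> ?R" "b \<in> ?R" for a b
    proof -
      obtain x u y v where "A x = Some u" "a = x + u" "A y = Some v" "b = y + v"
        using ab by (auto simp: ran_operator_sum_Some_iff)
      then have "A (x + y) = Some (u + v)" "a + b = (x + y) + (u + v)"
        using subspace_graphD(2)[OF sub] by auto
      then show ?thesis by (auto simp: ran_operator_sum_Some_iff)
    qed
    show "c *\<^sub>R a \<in> ?R" if "a \<in> ?R" for c a
      using that subspace_graphD(3)[OF sub]
      unfolding ran_operator_sum_Some_iff by (metis scaleR_add_right)
  qed
  \<comment> \<open>The lower bound turns convergence of the images into the Cauchy property of the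
    preimages \<open>x n\<close>. Symmetry passes to the limit \<open>a\<close> and gives the
    relation defining the adjoint there, with value \<open>l - a\<close>.\<close>
  moreover have "closed ?R"
    unfolding closed_sequential_limits
  proof (intro allI impI)
    fix f l assume "(\<forall>n. f n \<in> ?R) \<and> f \<longlonglongrightarrow> l"
    then have f: "\<And>n. \<exists>x u. A x = Some u \<and> f n = x + u" and l: "f \<longlonglongrightarrow> l"
      by (auto simp: ran_operator_sum_Some_iff)
    from f obtain x u where xu: "\<And>n. A (x n) = Some (u n)" "\<And>n. f n = x n + u n" by metis
    have le: "norm (x m - x n) \<le> norm (f m - f n)" for m n
      using bound[OF subspace_graphD(2)[OF sub xu(1)[of m] subspace_graphD(4)[OF sub xu(1)[of n]]]]
      by (simp add: xu(2) algebra_simps)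
    have "Cauchy f" using l LIMSEQ_imp_Cauchy by blast
    then have "Cauchy x"
      unfolding Cauchy_def dist_norm using le by (meson le_less_trans)
    then obtain a where a: "x \<longlonglongrightarrow> a" using Cauchy_convergent convergent_def by blast
    have "(\<lambda>n. f n - x n) \<longlonglongrightarrow> l - a" by (intro tendsto_intros l a)
    then have u: "u \<longlonglongrightarrow> l - a" by (simp add: xu(2))
    have "inner w a = inner y (l - a)" if "A y = Some w" for y w
    proof (rule LIMSEQ_unique)
      show "(\<lambda>n. inner w (x n)) \<longlonglongrightarrow> inner w a" by (intro tendsto_intros a)
      show "(\<lambda>n. inner w (x n)) \<longlonglongrightarrow> inner y (l - a)"
        unfolding sym[OF that xu(1)] by (intro tendsto_intros u)
    qed
    then have "A a = Some (l - a)" using A by blast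
    moreover have "l = a + (l - a)" by simp
    ultimately show "l \<in> ?R" unfolding ran_operator_sum_Some_iff by blast
  qed
  \<comment> \<open>Orthogonality to the range says that the adjoint, which is \<open>A\<close>,
    sends \<open>z\<close> to \<open>- z\<close>; nonnegativity then forces
    \<open>z = 0\<close>.\<close>
  moreover have "z = 0" if z: "z \<in> orth_compl inner ?R" for z
  proof -
    have "inner u z = inner x (- z)" if "A x = Some u" for x u
    proof -
      have "x + u \<in> ?R" using that by (auto simp: ran_operator_sum_Some_iff)
      then have "inner z (x + u) = 0" using z by (simp add: mem_orth_compl)
      then show ?thesis by (simp add: inner_add_right inner_commute)
    qed
    then have "A z = Some (- z)" using A by blast
    from nonneg[OF this] have "inner z z \<le> 0" by simp
    then show ?thesis using inner_gt_zero_iff[of z] by linarith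
  qed
  ultimately have "closure ?R = UNIV" by (intro dense_subspaceI)
  with \<open>closed ?R\<close> show "?R = UNIV" by (simp add: closure_closed)
next
  assume R: "ran (operator_sum Some A) = UNIV"
  have dense: "densely_defined A"
    unfolding densely_defined_def
  proof (rule dense_subspaceI[OF subspace_dom[OF sub]])
    fix z assume z: "z \<in> orth_compl inner (dom A)"
    \<comment> \<open>Testing \<open>z\<close> against its own preimage \<open>x\<close> under I + A
      gives a vanishing sum of two nonnegative terms.\<close>
    obtain x u where xu: "A x = Some u" "z = x + u" using R ran_operator_sum_Some_iff by blast
    have "inner z x = 0" using z xu(1) by (auto simp: mem_orth_compl)
    then have "inner x x + inner u x = 0" using xu(2) by (simp add: inner_add_left)
    then have "inner x x = 0" using nonneg[OF xu(1)] inner_ge_zero[of x] by linarith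
    then have "x = 0" by simp
    then show "z = 0" using xu subspace_graphD(1)[OF sub] by simp
  qed
  have "adjoint_operator inner inner A y = Some z \<longleftrightarrow> A y = Some z" for y z
    unfolding adjoint_operator_Some_iff[OF dense]
  proof
    assume adj: "\<forall>x u. A x = Some u \<longrightarrow> inner u y = inner x z"
    \<comment> \<open>The vector \<open>a\<close> in the domain has the image under I + A that
      \<open>y\<close> would have if \<open>A y\<close> were \<open>z\<close>. Writing
      \<open>y - a\<close> as a value of I + A as well shows that it is orthogonal to
      itself.\<close>
    obtain a b where ab: "A a = Some b" "y + z = a + b"
      using R ran_operator_sum_Some_iff by blast
    obtain x u where xu: "A x = Some u" "y - a = x + u"
      using R ran_operator_sum_Some_iff by blast
    have "inner (x + u) y = inner x (y + z)"
      using adj xu(1) by (simp add: inner_add_left inner_add_right)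
    also have "\<dots> = inner (x + u) a"
      using sym[OF xu(1) ab(1)] by (simp add: ab(2) inner_add_left inner_add_right)
    finally have "inner (y - a) (y - a) = 0" by (subst xu(2)) (simp add: inner_diff_right)
    then have "y = a" by simp
    then show "A y = Some z" using ab by simp
  qed (use sym in blast)
  then have "adjoint_operator inner inner A = A" by (metis ext not_Some_eq)
  then show "selfadjoint inner A" using dense by (simp add: selfadjoint_def)
qed

section \<open>Characterizations of closedness\<close>

locale dense_linear_operator =
  fixes T :: "'k::{real_inner, complete_space} \<rightharpoonup> 'h::{real_inner, complete_space}"
  assumes subspace_graph: "subspace (Map.graph T)"
    and dense: "densely_defined T"
begin

text \<open>Formed with the real inner products; agreement with the adjoint for the scalar-valued
  forms is established in the last section.\<close>

definition "Ts = adjoint_operator inner inner T"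

text \<open>The graph of \<open>T\<close> turned by the isometry that sends \<open>(x, u)\<close> to
  \<open>(- u, x)\<close>, which places it in the same product space as the graph of
  \<open>Ts\<close>.\<close>

definition "V = {(- u, x) | x u. T x = Some u}"

lemma Ts_iff: "Ts y = Some z \<longleftrightarrow> (\<forall>x u. T x = Some u \<longrightarrow> inner u y = inner x z)"
  unfolding Ts_def by (rule adjoint_operator_Some_iff[OF dense])

lemma adjoint: "T x = Some u \<Longrightarrow> Ts y = Some z \<Longrightarrow> inner u y = inner x z"
  by (simp add: Ts_iff)

lemma subspace_graph_Ts: "subspace (Map.graph Ts)"
  unfolding Ts_def by (rule subspace_graph_adjoint[OF dense])

lemmas T_linear = subspace_graphD[OF subspace_graph]
lemmas Ts_linear = subspace_graphD[OF subspace_graph_Ts]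

lemma subspace_V: "subspace V"
proof -
  have "V = (\<lambda>(x, u). (- u, x)) ` Map.graph T" by (auto simp: V_def graph_def image_iff)
  moreover have "linear (\<lambda>(x :: 'k, u :: 'h). (- u, x))"
    by (rule linearI) (auto simp: algebra_simps)
  ultimately show ?thesis using linear_subspace_image[OF _ subspace_graph] by simp
qed

lemma closed_V_iff: "closed V \<longleftrightarrow> closed_operator T"
proof -
  have V: "V = (\<lambda>p. (snd p, - fst p)) -` Map.graph T" by (force simp: V_def graph_def)
  have G: "Map.graph T = (\<lambda>p. (- snd p, fst p)) -` V" by (auto simp: V_def graph_def)
  have "closed V" if "closed (Map.graph T)"
    unfolding V by (rule closed_vimage[OF that]) (intro continuous_intros)
  moreover have "closed (Map.graph T)" if "closed V"
    unfolding G by (rule closed_vimage[OF that]) (intro continuous_intros)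
  ultimately show ?thesis by (auto simp: closed_operator_def)
qed

text \<open>The inner product of \<open>(h, k)\<close> with \<open>(- u, x)\<close> is
  \<open>inner x k - inner u h\<close>; its vanishing on \<open>V\<close> is the relation that
  defines the adjoint.\<close>

lemma orth_compl_V: "orth_compl inner V = Map.graph Ts"
proof -
  have "(h, k) \<in> orth_compl inner V \<longleftrightarrow> (h, k) \<in> Map.graph Ts" for h k
  proof -
    have "(h, k) \<in> orth_compl inner V \<longleftrightarrow> (\<forall>x u. T x = Some u \<longrightarrow> inner (h, k) (- u, x) = 0)"
      unfolding mem_orth_compl V_def by blast
    also have "\<dots> \<longleftrightarrow> (\<forall>x u. T x = Some u \<longrightarrow> inner u h = inner x k)"
    proof -
      have "inner (h, k) (- u, x) = inner x k - inner u h" for x u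
        by (simp add: inner_commute)
      then show ?thesis by auto
    qed
    also have "\<dots> \<longleftrightarrow> (h, k) \<in> Map.graph Ts"
      unfolding graph_def by (simp add: Ts_iff)
    finally show ?thesis .
  qed
  then show ?thesis by auto
qed

text \<open>The value at \<open>(h, k)\<close> splits as (- T k, k) + (h, Ts h), and the two
  summands range independently over \<open>V\<close> and its complement.\<close>

lemma ran_M_op_eq: "ran (M_op Ts T) = {v + w | v w. v \<in> V \<and> w \<in> orth_compl inner V}"
proof -
  have "p \<in> ran (M_op Ts T) \<longleftrightarrow> (\<exists>v w. p = v + w \<and> v \<in> V \<and> w \<in> Map.graph Ts)" for p
  proof
    assume "p \<in> ran (M_op Ts T)"
    then obtain h u k v where *: "Ts h = Some u" "T k = Some v" "p = (h - v, u + k)"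
      unfolding ran_M_op_iff by blast
    then have "p = (- v, k) + (h, u)" "(- v, k) \<in> V" "(h, u) \<in> Map.graph Ts"
      by (auto simp: V_def graph_def)
    then show "\<exists>v w. p = v + w \<and> v \<in> V \<and> w \<in> Map.graph Ts" by blast
  next
    assume "\<exists>v w. p = v + w \<and> v \<in> V \<and> w \<in> Map.graph Ts"
    then obtain h u k v where "Ts h = Some u" "T k = Some v" "p = (- v, k) + (h, u)"
      by (auto simp: V_def graph_def)
    moreover from this have "p = (h - v, u + k)" by simp
    ultimately show "p \<in> ran (M_op Ts T)" unfolding ran_M_op_iff by blast
  qed
  then show ?thesis unfolding orth_compl_V by blast
qed

lemma closed_iff_ran_M_op: "closed_operator T \<longleftrightarrow> ran (M_op Ts T) = UNIV"
  using closed_subspace_iff_decomposition(1)[OF subspace_V]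
  by (simp add: closed_V_iff ran_M_op_eq)

lemma closed_iff_orth_compl_graph:
  "closed_operator T \<longleftrightarrow> orth_compl inner (Map.graph Ts) \<subseteq> ran (M_op Ts T)"
  using closed_subspace_iff_decomposition(2)[OF subspace_V]
  by (simp add: closed_V_iff ran_M_op_eq orth_compl_V)

lemma ran_M_op_iff_ran_sums:
  "ran (M_op Ts T) = UNIV \<longleftrightarrow>
    ran (operator_sum Some (Ts \<circ>\<^sub>m T)) = UNIV \<and> ran (operator_sum Some (T \<circ>\<^sub>m Ts)) = UNIV"
proof (intro iffI conjI)
  assume R: "ran (M_op Ts T) = UNIV"
  have "y \<in> ran (operator_sum Some (Ts \<circ>\<^sub>m T))" for y
  proof -
    \<comment> \<open>A zero first component forces h = T k, so the second one becomes k + Ts (T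
      k).\<close>
    obtain h u k v where "Ts h = Some u" "T k = Some v" "(0, y) = (h - v, u + k)"
      using R ran_M_op_iff by blast
    then have "(Ts \<circ>\<^sub>m T) k = Some u" "y = k + u" by (auto simp: map_comp_Some_iff)
    then show ?thesis unfolding ran_operator_sum_Some_iff by blast
  qed
  then show "ran (operator_sum Some (Ts \<circ>\<^sub>m T)) = UNIV" by blast
  have "y \<in> ran (operator_sum Some (T \<circ>\<^sub>m Ts))" for y
  proof -
    \<comment> \<open>A zero second component forces k = - Ts h, so the first one becomes h + T (Ts
      h).\<close>
    obtain h u k v where *: "Ts h = Some u" "T k = Some v" "(y, 0) = (h - v, u + k)"
      using R ran_M_op_iff by blast
    then have "u = - k" by (simp add: eq_neg_iff_add_eq_0)
    then have "(T \<circ>\<^sub>m Ts) h = Some (- v)" "y = h + - v"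
      using * T_linear(4) by (auto simp: map_comp_Some_iff)
    then show ?thesis unfolding ran_operator_sum_Some_iff by blast
  qed
  then show "ran (operator_sum Some (T \<circ>\<^sub>m Ts)) = UNIV" by blast
next
  assume R: "ran (operator_sum Some (Ts \<circ>\<^sub>m T)) = UNIV \<and>
    ran (operator_sum Some (T \<circ>\<^sub>m Ts)) = UNIV"
  have "(a, b) \<in> ran (M_op Ts T)" for a b
  proof -
    obtain x u v where 1: "T x = Some u" "Ts u = Some v" "b = x + v"
      using R ran_operator_sum_Some_iff[of b "Ts \<circ>\<^sub>m T"] by (auto simp: map_comp_Some_iff)
    obtain y w z where 2: "Ts y = Some w" "T w = Some z" "a = y + z"
      using R ran_operator_sum_Some_iff[of a "T \<circ>\<^sub>m Ts"] by (auto simp: map_comp_Some_iff)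
    \<comment> \<open>Superposition: \<open>(u, x)\<close> is mapped to \<open>(0, b)\<close> and
      \<open>(y, - w)\<close> to \<open>(a, 0)\<close>.\<close>
    have "Ts (u + y) = Some (v + w)" using 1 2 Ts_linear(2) by blast
    moreover have "T (x + - w) = Some (u + - z)" using 1 2 T_linear(2,4) by blast
    moreover have "(a, b) = ((u + y) - (u + - z), (v + w) + (x + - w))" using 1 2 by simp
    ultimately show ?thesis unfolding ran_M_op_iff by blast
  qed
  then show "ran (M_op Ts T) = UNIV" by auto
qed

text \<open>Moving \<open>Ts\<close> across the inner product turns inner (Ts (T x)) y into inner (T
  x) (T y), which is symmetric and, for y = x, nonnegative.\<close>

lemma selfadjoint_Ts_T_iff:
  "selfadjoint inner (Ts \<circ>\<^sub>m T) \<longleftrightarrow> ran (operator_sum Some (Ts \<circ>\<^sub>m T)) = UNIV"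
proof (rule symmetric_nonneg_selfadjoint_iff)
  show "subspace (Map.graph (Ts \<circ>\<^sub>m T))"
    by (rule subspace_graph_comp[OF subspace_graph_Ts subspace_graph])
  show "inner u y = inner x v" if "(Ts \<circ>\<^sub>m T) x = Some u" "(Ts \<circ>\<^sub>m T) y = Some v" for x u y v
    using that adjoint by (auto simp: map_comp_Some_iff) (metis inner_commute)
  show "inner u x \<ge> 0" if "(Ts \<circ>\<^sub>m T) x = Some u" for x u
    using that adjoint by (auto simp: map_comp_Some_iff) (metis inner_commute inner_ge_zero)
qed

lemma selfadjoint_T_Ts_iff:
  "selfadjoint inner (T \<circ>\<^sub>m Ts) \<longleftrightarrow> ran (operator_sum Some (T \<circ>\<^sub>m Ts)) = UNIV"
proof (rule symmetric_nonneg_selfadjoint_iff)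
  show "subspace (Map.graph (T \<circ>\<^sub>m Ts))"
    by (rule subspace_graph_comp[OF subspace_graph subspace_graph_Ts])
  show "inner u y = inner x v" if "(T \<circ>\<^sub>m Ts) x = Some u" "(T \<circ>\<^sub>m Ts) y = Some v" for x u y v
    using that adjoint by (auto simp: map_comp_Some_iff) (metis inner_commute)
  show "inner u x \<ge> 0" if "(T \<circ>\<^sub>m Ts) x = Some u" for x u
    using that adjoint by (auto simp: map_comp_Some_iff)
qed

text \<open>Up to the rotation, the complement of the graph of \<open>Ts\<close> is the graph
  relation of the second adjoint, and it is also the double complement of \<open>V\<close>. For
  closed \<open>T\<close> it falls back into \<open>V\<close>; conversely, if the second adjoint is
  \<open>T\<close>, then \<open>V\<close> is a complement and hence closed.\<close>

lemma closed_iff_biadjoint: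
  "closed_operator T \<longleftrightarrow> densely_defined Ts \<and> adjoint_operator inner inner Ts = T"
proof (intro iffI conjI)
  assume "closed_operator T"
  then have cl: "closed V" by (simp add: closed_V_iff)
  \<comment> \<open>Phrased by the defining relation instead of \<open>adjoint_operator\<close>,
    because density of the domain of \<open>Ts\<close> is itself derived from it: a vector
    \<open>z\<close> orthogonal to that domain satisfies the relation with
    \<open>k = 0\<close>.\<close>
  have bi: "T k = Some h" if "\<And>x u. Ts x = Some u \<Longrightarrow> inner u k = inner x h" for k h
  proof -
    have "(- h, k) \<in> orth_compl inner (orth_compl inner V)"
      using that by (auto simp: orth_compl_V mem_orth_compl graph_def inner_commute)
    then have "(- h, k) \<in> V" by (rule closed_subspace_biorthogonal[OF subspace_V cl])
    then show ?thesis by (auto simp: V_def)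
  qed
  show dTs: "densely_defined Ts"
    unfolding densely_defined_def
  proof (rule dense_subspaceI[OF subspace_dom[OF subspace_graph_Ts]])
    fix z assume "z \<in> orth_compl inner (dom Ts)"
    then have "T 0 = Some z" by (intro bi) (auto simp: mem_orth_compl inner_commute)
    then show "z = 0" using T_linear(1) by simp
  qed
  have "adjoint_operator inner inner Ts y = Some z \<longleftrightarrow> T y = Some z" for y z
    unfolding adjoint_operator_Some_iff[OF dTs] using bi adjoint by (metis inner_commute)
  then show "adjoint_operator inner inner Ts = T" by (metis ext not_Some_eq)
next
  assume "densely_defined Ts \<and> adjoint_operator inner inner Ts = T"
  then have T: "T y = Some z \<longleftrightarrow> (\<forall>x u. Ts x = Some u \<longrightarrow> inner u y = inner x z)" for y z
    using adjoint_operator_Some_iff by metis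
  have "(h, k) \<in> V \<longleftrightarrow> (h, k) \<in> orth_compl inner (Map.graph Ts)" for h k
  proof -
    have "(h, k) \<in> V \<longleftrightarrow> T k = Some (- h)" by (force simp: V_def)
    also have "\<dots> \<longleftrightarrow> (\<forall>x u. Ts x = Some u \<longrightarrow> inner (h, k) (x, u) = 0)"
    proof -
      have "inner (h, k) (x, u) = 0 \<longleftrightarrow> inner u k = inner x (- h)" for x u
        by (auto simp: inner_commute[of u k] inner_commute[of x h])
      then show ?thesis unfolding T by (simp only:)
    qed
    also have "\<dots> \<longleftrightarrow> (h, k) \<in> orth_compl inner (Map.graph Ts)"
      unfolding mem_orth_compl graph_def by blast
    finally show ?thesis .
  qed
  then have "V = orth_compl inner (Map.graph Ts)" by auto
  then have "closed V" using closed_orth_compl_inner by metis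
  then show "closed_operator T" by (simp add: closed_V_iff)
qed

end

section \<open>Reduction to the real inner product\<close>

lemma scnj_diff: "scnj (x - y) = scnj x - scnj (y :: 'f::rc_field)"
proof -
  interpret additive "scnj :: 'f \<Rightarrow> 'f" by standard (rule scnj_add)
  show ?thesis by (rule diff)
qed

text \<open>The sum of a scalar and its conjugate is twice its real part. Choosing
  \<open>c = scnj d\<close> makes it twice the squared norm of \<open>d\<close>.\<close>

lemma trace_eq_0_imp_eq_0:
  fixes d :: "'f::rc_field"
  assumes "\<And>c. c * d + scnj (c * d) = 0"
  shows "d = 0"
proof -
  have "scnj d * d = of_real ((norm d)\<^sup>2)" using mult_scnj[of d] by (simp add: mult.commute)
  then have "of_real ((norm d)\<^sup>2 + (norm d)\<^sup>2) = (0 :: 'f)"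
    using assms[of "scnj d"] scnj_of_real[of "(norm d)\<^sup>2", where 'f = 'f] by simp
  then show ?thesis by (simp only: of_real_eq_0_iff) simp
qed

context hilbert_space
begin

lemma ip_add_right: "ip x (y + z) = ip x y + ip x z"
  using ip_commute[of x "y + z"] ip_commute[of x y] ip_commute[of x z]
  by (simp only: ip_add_left scnj_add)

lemma ip_scale_right: "ip x (scale c y) = scnj c * ip x y"
  using ip_commute[of x "scale c y"] ip_commute[of x y]
  by (simp only: ip_scale_left scnj_mult)

text \<open>Polarization: \<open>ip (x + y) (x + y)\<close> is expanded once by additivity of
  \<open>ip\<close> and once through the norm. Thus \<open>inner\<close> is the real part of
  \<open>ip\<close>.\<close>

lemma ip_trace: "ip x y + scnj (ip x y) = of_real (2 * inner x y)"
proof -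
  have "ip x x + ip y y + (ip x y + ip y x) = ip (x + y) (x + y)"
    by (simp add: ip_add_left ip_add_right algebra_simps)
  also have "\<dots> = of_real ((norm x)\<^sup>2 + (norm y)\<^sup>2 + 2 * inner x y)"
    unfolding ip_self power2_norm_eq_inner
    by (simp add: inner_add_left inner_add_right inner_commute)
  also have "\<dots> = ip x x + ip y y + of_real (2 * inner x y)" by (simp add: ip_self)
  finally show ?thesis using ip_commute[of y x] by simp
qed

lemma orth_compl_ip_eq_inner:
  assumes "\<And>c x. x \<in> S \<Longrightarrow> scale c x \<in> S"
  shows "orth_compl ip S = orth_compl inner S"
proof -
  have "inner x y = 0" if "ip x y = 0" for x y
    using ip_trace[of x y] that scnj_of_real[of 0, where 'f = 'f] by simp
  moreover have "ip x y = 0" if "x \<in> orth_compl inner S" "y \<in> S" for x y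
  proof (rule trace_eq_0_imp_eq_0)
    fix c
    \<comment> \<open>Conjugated because \<open>ip\<close> is conjugate-linear in its second
      argument, so that the factor \<open>c\<close> comes out.\<close>
    have "inner x (scale (scnj c) y) = 0" using that assms by (simp add: mem_orth_compl)
    then show "c * ip x y + scnj (c * ip x y) = 0"
      using ip_trace[of x "scale (scnj c) y"] by (simp add: ip_scale_right scnj_scnj)
  qed
  ultimately show ?thesis by (auto simp: orth_compl_def)
qed

end

text \<open>Supplies compatibility with all scalars, including invariance of the domain, which a
  real-linear graph does not record. It is what permits passing between \<open>ip\<close> and
  \<open>inner\<close>.\<close>

definition homogeneous_operator ::
  "('f \<Rightarrow> 'a \<Rightarrow> 'a) \<Rightarrow> ('f \<Rightarrow> 'b \<Rightarrow> 'b) \<Rightarrow> ('a \<rightharpoonup> 'b) \<Rightarrow> bool"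
  where "homogeneous_operator s t T \<longleftrightarrow>
    (\<forall>c x u. T x = Some u \<longrightarrow> T (s c x) = Some (t c u))"

lemma homogeneous_operator_comp:
  "homogeneous_operator t r A \<Longrightarrow> homogeneous_operator s t B \<Longrightarrow> homogeneous_operator s r (A \<circ>\<^sub>m B)"
  unfolding homogeneous_operator_def map_comp_Some_iff by blast

locale hilbert_space_pair =
  A: hilbert_space sA ipA + B: hilbert_space sB ipB
  for sA :: "'f::rc_field \<Rightarrow> 'a::{real_inner, complete_space} \<Rightarrow> 'a"
    and ipA :: "'a \<Rightarrow> 'a \<Rightarrow> 'f"
    and sB :: "'f \<Rightarrow> 'b::{real_inner, complete_space} \<Rightarrow> 'b"
    and ipB :: "'b \<Rightarrow> 'b \<Rightarrow> 'f"
begin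

lemma inner_eq_if_ip_eq:
  assumes "ipB u y = ipA x z"
  shows "inner u y = inner x z"
proof -
  have "(of_real (2 * inner u y) :: 'f) = of_real (2 * inner x z)"
    using assms A.ip_trace[of x z] B.ip_trace[of u y] by simp
  then show ?thesis by (simp only: of_real_eq_iff)
qed

text \<open>Scaling both first arguments by \<open>c\<close> multiplies the difference of the two
  forms by \<open>c\<close>; all these multiples have real part zero.\<close>

lemma ip_eq_if_inner_eq:
  assumes "\<And>c. inner (sB c u) y = inner (sA c x) z"
  shows "ipB u y = ipA x z"
proof -
  have "ipB u y - ipA x z = 0"
  proof (rule trace_eq_0_imp_eq_0)
    fix c
    have "c * ipB u y + scnj (c * ipB u y) = c * ipA x z + scnj (c * ipA x z)"
      using A.ip_trace[of "sA c x" z] B.ip_trace[of "sB c u" y] assms[of c]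
      by (simp add: A.ip_scale_left B.ip_scale_left)
    then show "c * (ipB u y - ipA x z) + scnj (c * (ipB u y - ipA x z)) = 0"
      by (simp add: right_diff_distrib scnj_diff algebra_simps)
  qed
  then show ?thesis by simp
qed

text \<open>The two conditions on \<open>z\<close> in the definition are equivalent, so the domains
  and the described vectors agree. Homogeneity allows testing the real relation on every scalar
  multiple of \<open>x\<close>.\<close>

lemma adjoint_operator_ip_eq_inner:
  assumes "homogeneous_operator sA sB T"
  shows "adjoint_operator ipA ipB T = adjoint_operator inner inner T"
proof -
  have "(\<forall>x\<in>dom T. ipB (the (T x)) y = ipA x z) \<longleftrightarrow>
      (\<forall>x\<in>dom T. inner (the (T x)) y = inner x z)" for y z
  proof
    assume I: "\<forall>x\<in>dom T. inner (the (T x)) y = inner x z"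
    show "\<forall>x\<in>dom T. ipB (the (T x)) y = ipA x z"
    proof
      fix x assume "x \<in> dom T"
      then obtain u where u: "T x = Some u" by blast
      have "inner (sB c u) y = inner (sA c x) z" for c
      proof -
        have "T (sA c x) = Some (sB c u)" using assms u by (simp add: homogeneous_operator_def)
        then show ?thesis using I by (metis domI option.sel)
      qed
      then show "ipB (the (T x)) y = ipA x z" using ip_eq_if_inner_eq u by simp
    qed
  qed (use inner_eq_if_ip_eq in blast)
  then show ?thesis by (intro ext) (simp add: adjoint_operator_def)
qed

text \<open>A general scalar moves across \<open>ip\<close> but not across \<open>inner\<close>,
  hence the detour through the scalar-valued forms.\<close>

lemma homogeneous_adjoint:
  assumes T: "homogeneous_operator sA sB T" "densely_defined T"
  shows "homogeneous_operator sB sA (adjoint_operator inner inner T)"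
  unfolding homogeneous_operator_def adjoint_operator_Some_iff[OF T(2)]
proof (intro allI impI)
  fix c y z x u
  assume adj: "\<forall>x u. T x = Some u \<longrightarrow> inner u y = inner x z" and "T x = Some u"
  then have "inner (sB d u) y = inner (sA d x) z" for d
    using T(1) by (simp add: homogeneous_operator_def)
  then have "ipB u y = ipA x z" by (rule ip_eq_if_inner_eq)
  then have "ipB u (sB c y) = ipA x (sA c z)" by (simp add: A.ip_scale_right B.ip_scale_right)
  then show "inner u (sB c y) = inner x (sA c z)" by (rule inner_eq_if_ip_eq)
qed

end

section \<open>From linear operators over the scalar field to real-linear graphs\<close>

lemma linear_operator_homogeneous:
  assumes "hilbert_space s ipA" "linear_operator s t T"
  shows "homogeneous_operator s t T"
proof -
  interpret A: hilbert_space s ipA by fact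
  show ?thesis
    unfolding homogeneous_operator_def
  proof (intro allI impI)
    fix c x u assume u: "T x = Some u"
    then have "x \<in> dom T" by blast
    then have "s c x \<in> dom T" "the (T (s c x)) = t c (the (T x))"
      using assms(2) A.subspace_scale unfolding linear_operator_def by blast+
    then show "T (s c x) = Some (t c u)" using u by auto
  qed
qed

lemma linear_operator_subspace_graph:
  assumes "hilbert_space s ipA" "hilbert_space t ipB" "linear_operator s t T"
  shows "subspace (Map.graph T)"
proof (rule subspace_graphI)
  interpret A: hilbert_space s ipA by fact
  interpret B: hilbert_space t ipB by fact
  have hom: "T (s c x) = Some (t c u)" if "T x = Some u" for c x u
    using linear_operator_homogeneous[OF assms(1,3)] that by (simp add: homogeneous_operator_def)
  have sub: "A.subspace (dom T)"
    and add: "\<And>x y. x \<in> dom T \<Longrightarrow> y \<in> dom T \<Longrightarrow> the (T (x + y)) = the (T x) + the (T y)"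
    using assms(3) by (auto simp: linear_operator_def)
  show "T (c *\<^sub>R x) = Some (c *\<^sub>R u)" if "T x = Some u" for c x u
    using hom[OF that, of "of_real c"] by (simp add: A.scale_of_real B.scale_of_real)
  show "T (x + y) = Some (u + v)" if "T x = Some u" "T y = Some v" for x y u v
    using A.subspace_add[OF sub, of x y] add[of x y] that by force
  obtain u where "T 0 = Some u" using A.subspace_0[OF sub] by blast
  from hom[OF this, of 0] show "T 0 = Some 0" by simp
qed

theorem theorem8p1:
  fixes scaleH :: "'f::rc_field \<Rightarrow> 'h::{real_inner, complete_space} \<Rightarrow> 'h"
    and ipH :: "'h \<Rightarrow> 'h \<Rightarrow> 'f"
    and scaleK :: "'f \<Rightarrow> 'k::{real_inner, complete_space} \<Rightarrow> 'k"
    and ipK :: "'k \<Rightarrow> 'k \<Rightarrow> 'f"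
    and T :: "'k \<rightharpoonup> 'h"
  assumes "hilbert_space scaleH ipH"
    and "hilbert_space scaleK ipK"
    and "linear_operator scaleK scaleH T"
    and "densely_defined T"
  shows "let Ts = adjoint_operator ipK ipH T in
    (closed_operator T \<longleftrightarrow> ran (M_op Ts T) = UNIV) \<and>
    (closed_operator T \<longleftrightarrow>
      ran (operator_sum Some (Ts \<circ>\<^sub>m T)) = UNIV \<and> ran (operator_sum Some (T \<circ>\<^sub>m Ts)) = UNIV) \<and>
    (closed_operator T \<longleftrightarrow>
      selfadjoint ipK (Ts \<circ>\<^sub>m T) \<and> selfadjoint ipH (T \<circ>\<^sub>m Ts)) \<and>
    (closed_operator T \<longleftrightarrow>
      orth_compl (ip_prod ipH ipK) (Map.graph Ts) \<subseteq> ran (M_op Ts T)) \<and>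
    (closed_operator T \<longleftrightarrow>
      densely_defined Ts \<and> adjoint_operator ipH ipK Ts = T)"
proof -
  \<comment> \<open>The four pairs serve the four adjoints: \<open>KH\<close> for that of
    \<open>T\<close>, \<open>HK\<close> for that of \<open>Ts\<close>, and \<open>KK\<close> and
    \<open>HH\<close> for those of the two products.\<close>
  interpret HK: hilbert_space_pair scaleH ipH scaleK ipK
    using assms(1,2) by (rule hilbert_space_pair.intro)
  interpret KH: hilbert_space_pair scaleK ipK scaleH ipH
    using assms(2,1) by (rule hilbert_space_pair.intro)
  interpret HH: hilbert_space_pair scaleH ipH scaleH ipH
    using assms(1,1) by (rule hilbert_space_pair.intro)
  interpret KK: hilbert_space_pair scaleK ipK scaleK ipK
    using assms(2,2) by (rule hilbert_space_pair.intro)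
  interpret P: hilbert_space "scale_prod scaleH scaleK" "ip_prod ipH ipK"
    using assms(1,2) by (rule hilbert_space_prod)
  interpret dense_linear_operator T
    using linear_operator_subspace_graph[OF assms(2,1,3)] assms(4)
    by (rule dense_linear_operator.intro)
  have hom: "homogeneous_operator scaleK scaleH T"
    by (rule linear_operator_homogeneous[OF assms(2,3)])
  have homs: "homogeneous_operator scaleH scaleK Ts"
    unfolding Ts_def by (rule KH.homogeneous_adjoint[OF hom assms(4)])
  have Ts: "adjoint_operator ipK ipH T = Ts"
    unfolding Ts_def by (rule KH.adjoint_operator_ip_eq_inner[OF hom])
  have Tss: "adjoint_operator ipH ipK Ts = adjoint_operator inner inner Ts"
    by (rule HK.adjoint_operator_ip_eq_inner[OF homs])
  have saK: "selfadjoint ipK (Ts \<circ>\<^sub>m T) \<longleftrightarrow> selfadjoint inner (Ts \<circ>\<^sub>m T)"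
    by (simp add: selfadjoint_def
        KK.adjoint_operator_ip_eq_inner[OF homogeneous_operator_comp[OF homs hom]])
  have saH: "selfadjoint ipH (T \<circ>\<^sub>m Ts) \<longleftrightarrow> selfadjoint inner (T \<circ>\<^sub>m Ts)"
    by (simp add: selfadjoint_def
        HH.adjoint_operator_ip_eq_inner[OF homogeneous_operator_comp[OF hom homs]])
  \<comment> \<open>Homogeneity of \<open>Ts\<close> makes its graph invariant under the product
    scaling.\<close>
  have orth: "orth_compl (ip_prod ipH ipK) (Map.graph Ts) = orth_compl inner (Map.graph Ts)"
    using homs
    by (intro P.orth_compl_ip_eq_inner)
      (auto simp: scale_prod_def graph_def homogeneous_operator_def)
  show ?thesis
    unfolding Let_def Ts Tss saK saH orth selfadjoint_Ts_T_iff selfadjoint_T_Ts_iff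
    using closed_iff_ran_M_op ran_M_op_iff_ran_sums closed_iff_orth_compl_graph
      closed_iff_biadjoint
    by (intro conjI) simp_all
qed

end
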